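(* Let $n\ge 1$. Among the simply paired partitions of $n$ having negative pairing rank, let $E_{\mathrm{sp}}(n)$ count those with $b(\lambda)$ even and let $O_{\mathrm{sp}}(n)$ count those with $b(\lambda)$ odd. Then $$E_{\mathrm{sp}}(n)-O_{\mathrm{sp}}(n)=d_{\mathrm{odd}}(n),$$ where $d_{\mathrm{odd}}(n)$ is the number of odd positive divisors of $n$.
   Context: A partition is simply paired if no part occurs more than three times. For a simply paired partition $\lambda$, $b(\lambda)$ is the number of distinct part sizes that participate in a pair, i.e. that occur two or three times. For a partition $\lambda$, let $r(\lambda)$ be the largest part size of multiplicity at least $2$ ($r(\lambda)=0$ if $\lambda$ has distinct parts). Let $u_1>u_2>\cdots$ be the part sizes occurring with odd multiplicity, each taken once, and let $s(\lambda)=u_1-u_2+u_3-u_4+\cdots$ ($0$ if there are none). The pairing rank is $\rho(\lambda)=r(\lambda)-s(\lambda)$. *)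

theory Defs
  imports "HOL-Library.Multiset"
begin

text \<open>A partition is the multiset of its parts, so \<open>count L x\<close> is the multiplicity of
  the part size \<open>x\<close>.\<close>

definition partitions_of :: "nat \<Rightarrow> nat multiset set" where
  "partitions_of n = {L. 0 \<notin># L \<and> \<Sum>\<^sub># L = n}"

definition simply_paired :: "nat multiset \<Rightarrow> bool" where
  "simply_paired L \<longleftrightarrow> (\<forall>x. count L x \<le> 3)"

definition num_pairs :: "nat multiset \<Rightarrow> nat" where
  "num_pairs L = card {x. count L x = 2 \<or> count L x = 3}"

text \<open>Inserting 0 gives the value 0 for partitions into distinct parts.\<close>

definition largest_repeated :: "nat multiset \<Rightarrow> nat" where
  "largest_repeated L = Max (insert 0 {x. count L x \<ge> 2})"

definition odd_mult_parts :: "nat multiset \<Rightarrow> nat list" where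
  "odd_mult_parts L = rev (sorted_list_of_set {x. odd (count L x)})"

text \<open>List indices start at 0, so the first (largest) entry has sign \<open>+\<close>.\<close>

definition alternating_odd_sum :: "nat multiset \<Rightarrow> int" where
  "alternating_odd_sum L =
     (\<Sum>i<length (odd_mult_parts L). (-1) ^ i * int (odd_mult_parts L ! i))"

definition pairing_rank :: "nat multiset \<Rightarrow> int" where
  "pairing_rank L = int (largest_repeated L) - alternating_odd_sum L"

definition E_sp :: "nat \<Rightarrow> nat" where
  "E_sp n = card {L \<in> partitions_of n.
     simply_paired L \<and> pairing_rank L < 0 \<and> even (num_pairs L)}"

definition O_sp :: "nat \<Rightarrow> nat" where
  "O_sp n = card {L \<in> partitions_of n.
     simply_paired L \<and> pairing_rank L < 0 \<and> odd (num_pairs L)}"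

definition d_odd :: "nat \<Rightarrow> nat" where
  "d_odd n = card {d. d dvd n \<and> odd d}"

text \<open>The cardinalities in \<open>E_sp\<close> and \<open>O_sp\<close> are those of finite sets.\<close>

lemma finite_partitions_of: "finite (partitions_of n)"
proof -
  have bounds: "set_mset L \<subseteq> {..\<Sum>\<^sub># L} \<and> size L \<le> \<Sum>\<^sub># L"
    if "0 \<notin># L" for L :: "nat multiset"
    using that by (induction L) (auto simp: trans_le_add2)
  have "partitions_of n \<subseteq> mset ` {xs. set xs \<subseteq> {..n} \<and> length xs \<le> n}"
  proof
    fix L assume "L \<in> partitions_of n"
    moreover obtain xs where "L = mset xs" using ex_mset by metis
    ultimately show "L \<in> mset ` {xs. set xs \<subseteq> {..n} \<and> length xs \<le> n}"
      using bounds[of L] by (auto simp: partitions_of_def)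
  qed
  then show ?thesis
    using finite_lists_length_le[of "{..n}" n] finite_subset by blast
qed

end

theory Submission
  imports Defs "HOL-Library.FuncSet" "HOL-Computational_Algebra.Polynomial"
begin

text \<open>
  A simply paired partition splits into the set \<open>U\<close> of its parts of odd multiplicity and the set
  \<open>P\<close> of its repeated parts, and these sets are arbitrary. Negative rank means that \<open>P\<close> lies below
  the alternating sum \<open>s\<close> of \<open>U\<close>, so summing over \<open>P\<close> with signs gives the factor
  \<open>(1 - X\<^sup>2) \<dots> (1 - X\<^bsup>2(s-1)\<^esup>)\<close>. On the other hand, the sets \<open>U\<close> with alternating sum \<open>s\<close> have
  generating function \<open>X\<^sup>s / ((1 - X\<^sup>2) \<dots> (1 - X\<^bsup>2s\<^esup>))\<close>. The product is \<open>X\<^sup>s / (1 - X\<^bsup>2s\<^esup>)\<close>, the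
  sum of all \<open>X\<^bsup>s(2m+1)\<^esup>\<close>. Restricting the parts to \<open>{1..n}\<close> turns these series into polynomials,
  with equalities modulo \<open>X\<^bsup>n+1\<^esup>\<close>.
\<close>

section \<open>Alternating sums of sets\<close>

definition alt_sum :: "nat set \<Rightarrow> int" where
  "alt_sum U = (let xs = rev (sorted_list_of_set U) in
     \<Sum>i<length xs. (-1) ^ i * int (xs ! i))"

lemma alternating_odd_sum_eq: "alternating_odd_sum L = alt_sum {x. odd (count L x)}"
  by (simp add: alternating_odd_sum_def alt_sum_def odd_mult_parts_def)

lemma alt_sum_empty [simp]: "alt_sum {} = 0"
  by (simp add: alt_sum_def)

text \<open>The new maximum comes first in the descending list, so every old entry moves one place
  and changes sign.\<close>

lemma alt_sum_insert_greater:
  assumes "finite U" "\<And>u. u \<in> U \<Longrightarrow> u < m"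
  shows "alt_sum (insert m U) = int m - alt_sum U"
proof -
  have "sorted_list_of_set (insert m U) = sorted_list_of_set U @ [m]"
    by (rule sorted_distinct_set_unique)
      (use assms in \<open>auto simp: sorted_append less_imp_le
        simp del: sorted_list_of_set_insert_remove\<close>)
  then show ?thesis
    using assms(1)
    by (simp add: alt_sum_def sum.lessThan_Suc_shift sum_negf
        del: sorted_list_of_set_insert_remove sum.lessThan_Suc)
qed

lemma alt_sum_insert_Suc:
  assumes "U \<subseteq> {1..N}"
  shows "alt_sum (insert (Suc N) U) = int (Suc N) - alt_sum U"
  using assms finite_subset [OF assms] by (intro alt_sum_insert_greater) auto

lemma Pow_Suc_atLeastAtMost:
  "Pow {1..Suc N} = Pow {1..N} \<union> insert (Suc N) ` Pow {1..N}"
proof -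
  have "{1..Suc N} = insert (Suc N) {1..N}" by auto
  then show ?thesis by (simp add: Pow_insert)
qed

text \<open>If \<open>Suc N\<close> belongs to the set, the sum is \<open>Suc N\<close> minus a
  number which by induction lies between 0 and \<open>N\<close>.\<close>

lemma alt_sum_bounds:
  assumes "U \<subseteq> {1..N}"
  shows "0 \<le> alt_sum U \<and> alt_sum U \<le> int N"
  using assms
proof (induction N arbitrary: U)
  case (Suc N)
  have "U \<in> Pow {1..N} \<union> insert (Suc N) ` Pow {1..N}"
    unfolding Pow_Suc_atLeastAtMost [symmetric] using Suc.prems by simp
  then consider "U \<subseteq> {1..N}" | V where "V \<subseteq> {1..N}" "U = insert (Suc N) V"
    by blast
  then show ?case
  proof cases
    case 1
    then show ?thesis using Suc.IH [of U] by simp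
  next
    case 2
    then show ?thesis using Suc.IH [of V] alt_sum_insert_Suc [of V N] by simp
  qed
qed simp

section \<open>Generating functions for a fixed alternating sum\<close>

definition X :: "int poly" where
  "X = monom 1 1"

lemma coeff_X_power: "coeff (X ^ k) n = (if k = n then 1 else 0)"
  by (simp add: X_def monom_power)

lemma X_power_dvd_coeff_eq:
  assumes "X ^ k dvd p - q" "n < k"
  shows "coeff p n = coeff q n"
  using assms by (simp add: X_def monom_power monom_1_dvd_iff')

definition distinct_gf :: "nat \<Rightarrow> nat \<Rightarrow> int poly" where
  "distinct_gf N s = (\<Sum>U | U \<subseteq> {1..N} \<and> alt_sum U = int s. X ^ \<Sum>U)"

definition pair_gf :: "nat \<Rightarrow> int poly" where
  "pair_gf m = (\<Prod>j=1..m. 1 - X ^ (2 * j))"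

lemma pair_gf_0 [simp]: "pair_gf 0 = 1"
  by (simp add: pair_gf_def)

lemma pair_gf_Suc: "pair_gf (Suc m) = pair_gf m * (1 - X ^ (2 * Suc m))"
  by (simp add: pair_gf_def)

text \<open>This permits cancellation in the integral domain of integer polynomials. Each factor has
  constant term 1.\<close>

lemma pair_gf_nonzero: "pair_gf m \<noteq> 0"
proof -
  have "1 - X ^ (2 * j) \<noteq> 0" if "j \<ge> 1" for j
  proof -
    have "coeff (1 - X ^ (2 * j)) 0 \<noteq> 0"
      using that by (simp add: coeff_X_power)
    then show ?thesis by force
  qed
  then show ?thesis by (simp add: pair_gf_def)
qed

lemma distinct_gf_eq_0:
  assumes "N < s"
  shows "distinct_gf N s = 0"
proof -
  have "alt_sum U \<noteq> int s" if "U \<subseteq> {1..N}" for U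
    using alt_sum_bounds [OF that] assms by simp
  then have no: "{U. U \<subseteq> {1..N} \<and> alt_sum U = int s} = {}"
    by blast
  show ?thesis unfolding distinct_gf_def no by simp
qed

text \<open>Split by whether \<open>Suc N\<close> belongs to \<open>U\<close>: removing it turns
  alternating sum \<open>s\<close> into \<open>Suc N - s\<close>, an exact subtraction by the
  assumption. Up to this reflection it is the Pascal recurrence for Gaussian binomials.\<close>

lemma distinct_gf_Suc:
  assumes "s \<le> Suc N"
  shows "distinct_gf (Suc N) s = distinct_gf N s + X ^ Suc N * distinct_gf N (Suc N - s)"
proof -
  let ?A = "{U. U \<subseteq> {1..N} \<and> alt_sum U = int s}"
  let ?B = "{U. U \<subseteq> {1..N} \<and> alt_sum U = int (Suc N - s)}"
  have fin: "finite ?A" "finite ?B"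
    by (rule finite_subset [of _ "Pow {1..N}"]; force)+
  have "{U. U \<subseteq> {1..Suc N} \<and> alt_sum U = int s} = {U \<in> Pow {1..Suc N}. alt_sum U = int s}"
    by (simp only: Pow_iff)
  also have "\<dots> = ?A \<union> insert (Suc N) ` {U. U \<subseteq> {1..N} \<and> alt_sum (insert (Suc N) U) = int s}"
    unfolding Pow_Suc_atLeastAtMost by blast
  also have "{U. U \<subseteq> {1..N} \<and> alt_sum (insert (Suc N) U) = int s} = ?B"
    using assms alt_sum_insert_Suc [of _ N] by (intro Collect_cong conj_cong refl) auto
  finally have split: "{U. U \<subseteq> {1..Suc N} \<and> alt_sum U = int s} = ?A \<union> insert (Suc N) ` ?B" .
  have notin: "Suc N \<notin> U" if "U \<subseteq> {1..N}" for U
    using that by auto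
  have inj: "inj_on (insert (Suc N)) ?B"
    using notin by (intro inj_onI) (metis insert_ident mem_Collect_eq)
  have "distinct_gf (Suc N) s = (\<Sum>U\<in>?A. X ^ \<Sum>U) + (\<Sum>U\<in>insert (Suc N) ` ?B. X ^ \<Sum>U)"
    unfolding distinct_gf_def split
    by (rule sum.union_disjoint) (use fin notin in auto)
  also have "(\<Sum>U\<in>insert (Suc N) ` ?B. X ^ \<Sum>U) = (\<Sum>U\<in>?B. X ^ Suc N * X ^ \<Sum>U)"
  proof (subst sum.reindex [OF inj], rule sum.cong)
    fix U assume U: "U \<in> ?B"
    then have "finite U" using finite_subset by blast
    then show "((\<lambda>U. X ^ \<Sum>U) \<circ> insert (Suc N)) U = X ^ Suc N * X ^ \<Sum>U"
      using U notin by (simp add: power_add)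
  qed simp
  finally show ?thesis
    by (simp add: distinct_gf_def sum_distrib_left)
qed

text \<open>So \<open>distinct_gf N s\<close> is \<open>X ^ s\<close> times the Gaussian binomial coefficient of \<open>N\<close> and \<open>s\<close>
  in base \<open>X\<^sup>2\<close>; the product form makes its symmetry under \<open>s \<mapsto> N - s\<close> evident.\<close>

lemma distinct_gf_mult_pair_gf:
  assumes "s \<le> N"
  shows "distinct_gf N s * pair_gf s * pair_gf (N - s) = X ^ s * pair_gf N"
  using assms
proof (induction N arbitrary: s)
  case 0
  have "{U::nat set. U \<subseteq> {1..0} \<and> alt_sum U = int 0} = {{}}" by auto
  then have "distinct_gf 0 0 = 1" unfolding distinct_gf_def by simp
  with 0 show ?case by simp
next
  case (Suc N)
  \<comment> \<open>The induction hypothesis at \<open>s\<close>, with the extra factor supplied by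
    \<open>pair_gf (Suc N - s)\<close>. For \<open>s = Suc N\<close> both sides vanish, the right
    one through its factor \<open>1 - X ^ 0\<close>.\<close>
  have old: "distinct_gf N s * pair_gf s * pair_gf (Suc N - s)
      = X ^ s * pair_gf N * (1 - X ^ (2 * (Suc N - s)))"
  proof (cases "s \<le> N")
    case True
    then show ?thesis
      using Suc.IH [of s] by (simp add: Suc_diff_le pair_gf_Suc mult_ac del: mult_Suc_right power_Suc)
  next
    case False
    with Suc.prems have "s = Suc N" by simp
    then show ?thesis by (simp add: distinct_gf_eq_0)
  qed
  \<comment> \<open>The mirror image: the hypothesis at \<open>Suc N - s\<close>, with the extra
    factor supplied by \<open>pair_gf s\<close>. Now \<open>s = 0\<close> is the case where both
    sides vanish.\<close>
  have new: "distinct_gf N (Suc N - s) * pair_gf s * pair_gf (Suc N - s)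
      = X ^ (Suc N - s) * pair_gf N * (1 - X ^ (2 * s))"
  proof (cases s)
    case 0
    then show ?thesis by (simp add: distinct_gf_eq_0)
  next
    case (Suc t)
    then have "N - (Suc N - s) = t" "Suc N - s \<le> N" using Suc.prems by auto
    then show ?thesis
      using Suc.IH [of "Suc N - s"] by (simp add: Suc pair_gf_Suc mult_ac del: mult_Suc_right power_Suc)
  qed
  obtain d where d: "Suc N = s + d" using Suc.prems le_Suc_ex by blast
  have "distinct_gf (Suc N) s * pair_gf s * pair_gf (Suc N - s)
      = X ^ s * pair_gf N * (1 - X ^ (2 * (Suc N - s)))
      + X ^ Suc N * (X ^ (Suc N - s) * pair_gf N * (1 - X ^ (2 * s)))"
    unfolding distinct_gf_Suc [OF Suc.prems] old [symmetric] new [symmetric]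
    by (simp add: algebra_simps)
  \<comment> \<open>With \<open>Suc N = s + d\<close>, the two terms in
    \<open>X ^ (s + 2 * d)\<close> cancel.\<close>
  also have "\<dots> = X ^ s * pair_gf N * (1 - X ^ (2 * Suc N))"
    unfolding d by (simp add: algebra_simps power_add power_mult power2_eq_square)
  finally show ?case by (simp add: pair_gf_Suc mult_ac)
qed

section \<open>Congruences modulo powers of \<open>X\<close>\<close>

lemma X_power_dvd_pair_prod:
  assumes "finite J" "\<And>j. j \<in> J \<Longrightarrow> k \<le> 2 * j"
  shows "X ^ k dvd (\<Prod>j\<in>J. 1 - X ^ (2 * j)) - 1"
  using assms
proof (induction J rule: finite_induct)
  case (insert i J)
  let ?p = "\<Prod>j\<in>J. 1 - X ^ (2 * j)"
  have "X ^ k dvd (?p - 1) - X ^ (2 * i) * ?p"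
    using insert.IH insert.prems by (meson dvd_diff dvd_mult2 insertCI le_imp_power_dvd)
  then show ?case
    using insert by (simp add: algebra_simps)
qed simp

text \<open>Cancelling \<open>pair_gf (n - s)\<close> in the product formula leaves
  \<open>B * (1 - X ^ (2 * s)) = X ^ s * R\<close>, where \<open>R\<close> collects the factors with
  index above \<open>n - s\<close>. These are too high to affect \<open>X ^ s * R\<close> modulo
  \<open>X ^ Suc n\<close>, and division by \<open>1 - X ^ (2 * s)\<close> becomes multiplication by
  a truncated geometric series.\<close>

lemma distinct_gf_mult_pair_gf_mod:
  assumes "1 \<le> s" "s \<le> n"
  shows "X ^ Suc n dvd distinct_gf n s * pair_gf (s - 1) - (\<Sum>m\<le>n. X ^ (s * (2 * m + 1)))"
proof -
  define B where "B = distinct_gf n s * pair_gf (s - 1)"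
  define R where "R = (\<Prod>j\<in>{n - s<..n}. 1 - X ^ (2 * j))"
  let ?geom = "\<Sum>m\<le>n. (X ^ (2 * s)) ^ m"
  have split: "pair_gf n = pair_gf (n - s) * R"
  proof -
    have "{1..n} = {1..n - s} \<union> {n - s<..n}" by auto
    then show ?thesis
      unfolding pair_gf_def R_def by (simp only:) (rule prod.union_disjoint, auto)
  qed
  have "B * (1 - X ^ (2 * s)) * pair_gf (n - s) = X ^ s * R * pair_gf (n - s)"
  proof -
    have "pair_gf s = pair_gf (s - 1) * (1 - X ^ (2 * s))"
      using assms pair_gf_Suc [of "s - 1"] by simp
    then show ?thesis
      using distinct_gf_mult_pair_gf [OF assms(2)] split by (simp add: B_def mult_ac)
  qed
  then have B: "B * (1 - X ^ (2 * s)) = X ^ s * R"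
    using pair_gf_nonzero by simp
  have geom: "1 - (X ^ (2 * s)) ^ Suc n = (1 - X ^ (2 * s)) * ?geom"
    using one_diff_power_eq [of "X ^ (2 * s)" "Suc n"] by (simp only: lessThan_Suc_atMost)
  \<comment> \<open>Two errors have to be divisible by \<open>X ^ Suc n\<close>: one from truncating
    the geometric series, one from replacing \<open>R\<close> by 1.\<close>
  have "B - X ^ s * ?geom = B * (X ^ (2 * s)) ^ Suc n + (B * (1 - X ^ (2 * s)) - X ^ s) * ?geom"
  proof -
    have *: "B * (1 - X ^ (2 * s)) * ?geom = B - B * (X ^ (2 * s)) ^ Suc n"
      unfolding mult.assoc geom [symmetric] by (simp only: right_diff_distrib mult_1_right)
    show ?thesis
      unfolding left_diff_distrib [of "B * (1 - X ^ (2 * s))"] * by simp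
  qed
  also have "B * (1 - X ^ (2 * s)) - X ^ s = X ^ s * (R - 1)"
    unfolding B by (simp add: algebra_simps)
  finally have eq: "B - X ^ s * ?geom = B * (X ^ (2 * s)) ^ Suc n + X ^ s * (R - 1) * ?geom" .
  have "X ^ Suc n dvd (X ^ (2 * s)) ^ Suc n"
    unfolding power_mult [symmetric] using assms by (intro le_imp_power_dvd) (cases s; simp)
  moreover have "X ^ Suc n dvd X ^ s * (R - 1)"
  proof -
    have "X ^ (2 * Suc (n - s)) dvd R - 1"
      unfolding R_def by (rule X_power_dvd_pair_prod) auto
    then have "X ^ (s + 2 * Suc (n - s)) dvd X ^ s * (R - 1)"
      by (simp only: power_add mult_dvd_mono dvd_refl)
    \<comment> \<open>The exponent is \<open>2 * n - s + 2\<close>, which exceeds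
      \<open>n + 1\<close> because \<open>s\<close> is at most \<open>n\<close>.\<close>
    moreover have "X ^ Suc n dvd X ^ (s + 2 * Suc (n - s))"
      using assms by (intro le_imp_power_dvd) simp
    ultimately show ?thesis using dvd_trans by blast
  qed
  ultimately have "X ^ Suc n dvd B - X ^ s * ?geom"
    unfolding eq by (simp only: dvd_add dvd_mult dvd_mult2)
  also have "X ^ s * ?geom = (\<Sum>m\<le>n. X ^ (s * (2 * m + 1)))"
    by (simp add: sum_distrib_left power_mult [symmetric] power_add [symmetric] algebra_simps)
  finally show ?thesis unfolding B_def .
qed

lemma coeff_distinct_gf_mult_pair_gf:
  assumes "1 \<le> s" "s \<le> n"
  shows "coeff (distinct_gf n s * pair_gf (s - 1)) n = int (card {m. m \<le> n \<and> s * (2 * m + 1) = n})"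
proof -
  have "coeff (distinct_gf n s * pair_gf (s - 1)) n = coeff (\<Sum>m\<le>n. X ^ (s * (2 * m + 1))) n"
    by (rule X_power_dvd_coeff_eq [OF distinct_gf_mult_pair_gf_mod [OF assms]]) simp
  also have "\<dots> = (\<Sum>m\<le>n. if s * (2 * m + 1) = n then 1 else 0)"
    by (simp only: coeff_sum coeff_X_power)
  also have "\<dots> = int (card ({..n} \<inter> {m. s * (2 * m + 1) = n}))"
    by (simp add: sum.If_cases)
  also have "{..n} \<inter> {m. s * (2 * m + 1) = n} = {m. m \<le> n \<and> s * (2 * m + 1) = n}"
    by auto
  finally show ?thesis .
qed

section \<open>Odd divisors, and expansion of the pair product\<close>

lemma d_odd_eq_sum:
  assumes "n \<ge> 1"
  shows "d_odd n = (\<Sum>s=1..n. card {m. m \<le> n \<and> s * (2 * m + 1) = n})"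
proof -
  let ?S = "SIGMA s:{1..n}. {m. m \<le> n \<and> s * (2 * m + 1) = n}"
  have "bij_betw (\<lambda>(s, m). 2 * m + 1) ?S {d. d dvd n \<and> odd d}"
  \<comment> \<open>An odd divisor \<open>d\<close> is \<open>2 * m + 1\<close> with
    \<open>m = d div 2\<close>, and \<open>s\<close> is the complementary divisor
    \<open>n div d\<close>.\<close>
  proof (rule bij_betwI [where g = "\<lambda>d. (n div d, d div 2)"])
    show "(\<lambda>(s, m). 2 * m + 1) \<in> ?S \<rightarrow> {d. d dvd n \<and> odd d}"
      using dvd_triv_right by fastforce
    show "(\<lambda>d. (n div d, d div 2)) \<in> {d. d dvd n \<and> odd d} \<rightarrow> ?S"
    proof
      fix d assume "d \<in> {d. d dvd n \<and> odd d}"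
      then have d: "d dvd n" "odd d" by auto
      then have "d \<le> n" "d > 0" using assms by (auto intro: dvd_imp_le odd_pos)
      moreover have "n div d * (2 * (d div 2) + 1) = n"
        using d by simp
      ultimately show "(n div d, d div 2) \<in> ?S"
        by (auto simp: div_greater_zero_iff Suc_le_eq)
    qed
    fix x assume "x \<in> ?S"
    then obtain s m where x: "x = (s, m)" "s * (2 * m + 1) = n" by blast
    then have "n div (2 * m + 1) = s"
      using nonzero_mult_div_cancel_right [of "2 * m + 1" s] by simp
    with x show "(\<lambda>d. (n div d, d div 2)) ((\<lambda>(s, m). 2 * m + 1) x) = x"
      by simp
  next
    fix d assume "d \<in> {d. d dvd n \<and> odd d}"
    then show "(\<lambda>(s, m). 2 * m + 1) (n div d, d div 2) = d" by simp
  qed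
  then show ?thesis
    by (simp add: d_odd_def bij_betw_same_card [symmetric])
qed

text \<open>Expanding the product selects the set \<open>P\<close> of factors that contribute
  \<open>- (X ^ (2 * j))\<close>. Read as the set of paired sizes, \<open>P\<close> thus carries the
  sign by which the theorem counts.\<close>

lemma prod_one_minus_X_power:
  assumes "finite J"
  shows "(\<Prod>j\<in>J. 1 - X ^ (2 * j)) = (\<Sum>P\<in>Pow J. (-1) ^ card P * X ^ (2 * \<Sum>P))"
proof -
  have "(\<Prod>j\<in>J. 1 - X ^ (2 * j)) = (\<Prod>j\<in>J. - (X ^ (2 * j)) + 1)"
    by simp
  also have "\<dots> = (\<Sum>P\<in>Pow J. \<Prod>j\<in>P. - (X ^ (2 * j)))"
    by (simp only: prod_add [OF assms] prod.neutral_const mult_1_right)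
  also have "\<dots> = (\<Sum>P\<in>Pow J. (-1) ^ card P * X ^ (2 * \<Sum>P))"
    by (simp add: prod_uminus power_sum sum_distrib_left)
  finally show ?thesis .
qed

section \<open>Simply paired partitions as pairs of sets\<close>

definition signed_pairs :: "nat \<Rightarrow> (nat set \<times> nat set) set" where
  "signed_pairs n = {(U, P). U \<subseteq> {1..n} \<and> P \<subseteq> {1..<nat (alt_sum U)} \<and> 0 < alt_sum U
     \<and> \<Sum>U + 2 * \<Sum>P = n}"


text \<open>This writes multiplicities 0 to 3 in binary: membership in \<open>U\<close> is the low
  bit and membership in \<open>P\<close> the high bit, so a part occurring three times lies in both
  sets.\<close>

definition multiset_of_pair :: "nat set \<times> nat set \<Rightarrow> nat multiset" where
  "multiset_of_pair = (\<lambda>(U, P). mset_set U + mset_set P + mset_set P)"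

lemma count_multiset_of_pair:
  assumes "finite U" "finite P"
  shows "count (multiset_of_pair (U, P)) x = (if x \<in> U then 1 else 0) + (if x \<in> P then 2 else 0)"
  using assms by (simp add: multiset_of_pair_def)

lemma sum_mset_multiset_of_pair: "\<Sum>\<^sub># (multiset_of_pair (U, P)) = \<Sum>U + 2 * \<Sum>P"
  by (simp add: multiset_of_pair_def sum_unfold_sum_mset)

lemma sets_of_multiset_of_pair:
  assumes "finite U" "finite P"
  shows "{x. odd (count (multiset_of_pair (U, P)) x)} = U"
    and "{x. count (multiset_of_pair (U, P)) x \<ge> 2} = P"
    and "simply_paired (multiset_of_pair (U, P))"
  by (auto simp: count_multiset_of_pair assms simply_paired_def)

lemma finite_count_ge: "0 < k \<Longrightarrow> finite {x. k \<le> count L x}"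
  by (rule finite_subset [of _ "set_mset L"])
    (auto simp flip: count_greater_zero_iff simp del: count_greater_zero_iff)

lemma finite_odd_count: "finite {x. odd (count L x)}"
  by (rule finite_subset [of _ "set_mset L"])
    (auto simp: odd_pos simp flip: count_greater_zero_iff simp del: count_greater_zero_iff)

lemma multiset_of_pair_sets:
  assumes "simply_paired L"
  shows "multiset_of_pair ({x. odd (count L x)}, {x. 2 \<le> count L x}) = L"
proof (rule multiset_eqI)
  fix x
  have "count L x \<le> 3"
    using assms by (simp add: simply_paired_def)
  then consider "count L x = 0" | "count L x = 1" | "count L x = 2" | "count L x = 3"
    by linarith
  then show "count (multiset_of_pair ({x. odd (count L x)}, {x. 2 \<le> count L x})) x = count L x"
    by cases (simp_all add: count_multiset_of_pair finite_count_ge finite_odd_count)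
qed

lemma num_pairs_eq:
  assumes "simply_paired L"
  shows "num_pairs L = card {x. 2 \<le> count L x}"
proof -
  have "count L x = 2 \<or> count L x = 3 \<longleftrightarrow> 2 \<le> count L x" for x
    using assms [unfolded simply_paired_def, rule_format, of x] by linarith
  then show ?thesis by (simp add: num_pairs_def)
qed

text \<open>A maximum is below a bound iff all its arguments are. The 0 inserted in
  \<open>largest_repeated\<close> yields the first conjunct, the repeated sizes yield the
  second.\<close>

lemma pairing_rank_neg_iff:
  "pairing_rank L < 0 \<longleftrightarrow> 0 < alt_sum {x. odd (count L x)}
     \<and> (\<forall>x. 2 \<le> count L x \<longrightarrow> int x < alt_sum {x. odd (count L x)})"
proof -
  have "int (largest_repeated L) < s \<longleftrightarrow> 0 < s \<and> (\<forall>x. 2 \<le> count L x \<longrightarrow> int x < s)" for s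
  proof -
    \<comment> \<open>In the naturals \<open>Max_less_iff\<close> applies. A nonpositive
      \<open>s\<close> becomes 0, and both sides are then false.\<close>
    have "int (largest_repeated L) < s \<longleftrightarrow> largest_repeated L < nat s"
      by (simp only: zless_nat_eq_int_zless)
    also have "\<dots> \<longleftrightarrow> 0 < nat s \<and> (\<forall>x. 2 \<le> count L x \<longrightarrow> x < nat s)"
      unfolding largest_repeated_def by (subst Max_less_iff) (auto simp: finite_count_ge)
    finally show ?thesis
      by (simp add: zless_nat_eq_int_zless)
  qed
  then show ?thesis
    by (simp add: pairing_rank_def alternating_odd_sum_eq)
qed

lemma member_le_sum_mset: "x \<in># L \<Longrightarrow> x \<le> \<Sum>\<^sub># L" for x :: nat
  by (metis le_add1 multi_member_split sum_mset.add_mset)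

text \<open>The left side sums \<open>(-1) ^ num_pairs L\<close> over the partitions counted, and
  the binary encoding is a bijection that turns \<open>num_pairs L\<close> into
  \<open>card P\<close>.\<close>

lemma signed_count_eq:
  "int (E_sp n) - int (O_sp n) = (\<Sum>(U, P)\<in>signed_pairs n. (-1) ^ card P)"
proof -
  let ?S = "{L \<in> partitions_of n. simply_paired L \<and> pairing_rank L < 0}"
  have fin: "finite ?S" using finite_partitions_of by simp
  have "(\<Sum>L\<in>?S. (-1) ^ num_pairs L :: int)
      = (\<Sum>L\<in>?S. (if even (num_pairs L) then 1 else 0) - (if odd (num_pairs L) then 1 else 0))"
    by (rule sum.cong) auto
  also have "\<dots> = int (card (?S \<inter> {L. even (num_pairs L)})) - int (card (?S \<inter> {L. odd (num_pairs L)}))"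
    using fin by (simp add: sum_subtractf sum.If_cases)
  also have "?S \<inter> {L. even (num_pairs L)}
      = {L \<in> partitions_of n. simply_paired L \<and> pairing_rank L < 0 \<and> even (num_pairs L)}" by auto
  also have "?S \<inter> {L. odd (num_pairs L)}
      = {L \<in> partitions_of n. simply_paired L \<and> pairing_rank L < 0 \<and> odd (num_pairs L)}" by auto
  finally have "int (E_sp n) - int (O_sp n) = (\<Sum>L\<in>?S. (-1) ^ num_pairs L)"
    by (simp add: E_sp_def O_sp_def)
  also have "\<dots> = (\<Sum>(U, P)\<in>signed_pairs n. (-1) ^ card P)"
  proof (rule sum.reindex_bij_witness [where i = multiset_of_pair
        and j = "\<lambda>L. ({x. odd (count L x)}, {x. 2 \<le> count L x})"])
    fix L assume L: "L \<in> ?S"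
    let ?U = "{x. odd (count L x)}" and ?P = "{x. 2 \<le> count L x}"
    show *: "multiset_of_pair (?U, ?P) = L"
      using L by (intro multiset_of_pair_sets) simp
    \<comment> \<open>No part of a partition of \<open>n\<close> exceeds \<open>n\<close>, so
      restricting the sets to \<open>{1..n}\<close> loses nothing.\<close>
    have parts: "1 \<le> x \<and> x \<le> n" if "0 < count L x" for x
      using L that member_le_sum_mset [of x L]
      by (cases "x = 0") (auto simp: partitions_of_def not_in_iff)
    have "?U \<subseteq> {1..n}"
      using parts [OF odd_pos] by auto
    moreover have pos: "0 < alt_sum ?U"
      and below: "2 \<le> count L x \<Longrightarrow> int x < alt_sum ?U" for x
      using L pairing_rank_neg_iff [of L] by auto
    moreover have "?P \<subseteq> {1..<nat (alt_sum ?U)}"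
    proof
      fix x assume "x \<in> ?P"
      then have "2 \<le> count L x" by simp
      then have "1 \<le> x" "int x < alt_sum ?U"
        using parts [of x] below [of x] by linarith+
      then show "x \<in> {1..<nat (alt_sum ?U)}" by simp
    qed
    moreover have "\<Sum>?U + 2 * \<Sum>?P = n"
      using L sum_mset_multiset_of_pair [of ?U ?P] by (simp add: * partitions_of_def)
    ultimately show "(?U, ?P) \<in> signed_pairs n"
      by (simp add: signed_pairs_def)
    show "(case (?U, ?P) of (U, P) \<Rightarrow> (-1) ^ card P) = (-1 :: int) ^ num_pairs L"
      using L by (simp add: num_pairs_eq)
  next
    fix UP assume UP: "UP \<in> signed_pairs n"
    obtain U P where [simp]: "UP = (U, P)" by (cases UP)
    have U: "U \<subseteq> {1..n}" and P: "P \<subseteq> {1..<nat (alt_sum U)}" and pos: "0 < alt_sum U"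
      and sum: "\<Sum>U + 2 * \<Sum>P = n"
      using UP by (auto simp: signed_pairs_def)
    have fin: "finite U" "finite P" using U P finite_subset by blast+
    show "({x. odd (count (multiset_of_pair UP) x)}, {x. 2 \<le> count (multiset_of_pair UP) x}) = UP"
      using sets_of_multiset_of_pair [OF fin] by simp
    have "multiset_of_pair (U, P) \<in> partitions_of n"
      unfolding partitions_of_def mem_Collect_eq sum_mset_multiset_of_pair sum
      using U P fin by (auto simp: multiset_of_pair_def)
    moreover have "pairing_rank (multiset_of_pair (U, P)) < 0"
    proof -
      have "int x < alt_sum U" if "2 \<le> count (multiset_of_pair (U, P)) x" for x
      proof -
        have "x \<in> P"
          using that sets_of_multiset_of_pair(2) [OF fin] by blast
        then show ?thesis
          using P by (auto simp flip: zless_nat_eq_int_zless)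
      qed
      then show ?thesis
        using pos unfolding pairing_rank_neg_iff sets_of_multiset_of_pair(1) [OF fin] by simp
    qed
    ultimately show "multiset_of_pair UP \<in> ?S"
      using sets_of_multiset_of_pair(3) [OF fin] by simp
  qed
  finally show ?thesis .
qed

section \<open>The signed sum as a sum of coefficients\<close>

lemma signed_pairs_sum:
  "(\<Sum>(U, P)\<in>signed_pairs n. (-1) ^ card P) = (\<Sum>s=1..n. coeff (distinct_gf n s * pair_gf (s - 1)) n)"
proof -
  let ?A = "{U. U \<subseteq> {1..n} \<and> 0 < alt_sum U}"
  let ?J = "\<lambda>U. {1..<nat (alt_sum U)}"
  have fin: "finite ?A"
    by (rule finite_subset [of _ "Pow {1..n}"]) auto
  \<comment> \<open>For fixed \<open>U\<close> the size condition extracts the coefficient of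
    \<open>X ^ n\<close>. The index of \<open>pair_gf\<close> is one less than the alternating sum
    because paired sizes lie strictly below it.\<close>
  have inner: "(\<Sum>P\<in>Pow (?J U). if \<Sum>U + 2 * \<Sum>P = n then (-1) ^ card P else 0)
      = coeff (X ^ \<Sum>U * pair_gf (nat (alt_sum U) - 1)) n" if "U \<in> ?A" for U
  proof -
    have J: "{1..nat (alt_sum U) - 1} = ?J U"
      using that by auto
    have "X ^ \<Sum>U * pair_gf (nat (alt_sum U) - 1)
        = (\<Sum>P\<in>Pow (?J U). smult ((-1) ^ card P) (X ^ (\<Sum>U + 2 * \<Sum>P)))"
      unfolding pair_gf_def J
      by (subst prod_one_minus_X_power)
        (auto simp: sum_distrib_left power_add minus_one_power_iff intro!: sum.cong)
    then show ?thesis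
      by (simp add: coeff_sum coeff_X_power if_distrib cong: if_cong)
  qed
  have "signed_pairs n = (SIGMA U:?A. Pow (?J U)) \<inter> {(U, P). \<Sum>U + 2 * \<Sum>P = n}"
    by (auto simp: signed_pairs_def)
  then have "(\<Sum>(U, P)\<in>signed_pairs n. (-1) ^ card P)
      = (\<Sum>(U, P)\<in>(SIGMA U:?A. Pow (?J U)). if \<Sum>U + 2 * \<Sum>P = n then (-1 :: int) ^ card P else 0)"
    using fin by (simp add: sum.inter_restrict case_prod_unfold)
  also have "\<dots> = (\<Sum>U\<in>?A. coeff (X ^ \<Sum>U * pair_gf (nat (alt_sum U) - 1)) n)"
    using fin inner by (simp add: sum.Sigma [symmetric])
  \<comment> \<open>Group the sets by alternating sum, which \<open>alt_sum_bounds\<close> and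
    positivity confine to \<open>{1..n}\<close>; the second factor is then constant on each
    group.\<close>
  also have "\<dots> = (\<Sum>s=1..n. \<Sum>U | U \<in> ?A \<and> nat (alt_sum U) = s.
      coeff (X ^ \<Sum>U * pair_gf (nat (alt_sum U) - 1)) n)"
  proof (rule sum.group [symmetric])
    show "(\<lambda>U. nat (alt_sum U)) ` ?A \<subseteq> {1..n}"
    proof
      fix s assume "s \<in> (\<lambda>U. nat (alt_sum U)) ` ?A"
      then obtain U where "U \<subseteq> {1..n}" "0 < alt_sum U" "s = nat (alt_sum U)" by blast
      then show "s \<in> {1..n}" using alt_sum_bounds [of U n] by auto
    qed
  qed (use fin in simp_all)
  also have "\<dots> = (\<Sum>s=1..n. coeff (distinct_gf n s * pair_gf (s - 1)) n)"
  proof (rule sum.cong [OF refl])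
    fix s assume "s \<in> {1..n}"
    then have "{U. U \<in> ?A \<and> nat (alt_sum U) = s} = {U. U \<subseteq> {1..n} \<and> alt_sum U = int s}"
      by auto
    then show "(\<Sum>U | U \<in> ?A \<and> nat (alt_sum U) = s. coeff (X ^ \<Sum>U * pair_gf (nat (alt_sum U) - 1)) n)
        = coeff (distinct_gf n s * pair_gf (s - 1)) n"
      by (simp add: distinct_gf_def sum_distrib_right coeff_sum)
  qed
  finally show ?thesis .
qed

theorem theorem6p2:
  fixes n :: nat
  assumes "n \<ge> 1"
  shows "int (E_sp n) - int (O_sp n) = int (d_odd n)"
proof -
  have "int (E_sp n) - int (O_sp n) = (\<Sum>s=1..n. coeff (distinct_gf n s * pair_gf (s - 1)) n)"
    by (simp only: signed_count_eq signed_pairs_sum)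
  also have "\<dots> = (\<Sum>s=1..n. int (card {m. m \<le> n \<and> s * (2 * m + 1) = n}))"
    by (rule sum.cong [OF refl], rule coeff_distinct_gf_mult_pair_gf) auto
  also have "\<dots> = int (d_odd n)"
    by (simp add: d_odd_eq_sum [OF assms])
  finally show ?thesis .
qed

end
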